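(* Let $\alpha\in\mathbb{R}$ with $-\pi/2<\alpha<\pi/2$, and let $f\in\mathcal{S}_{\alpha}$. Then the Schwarzian norm of $f$ satisfies $$\|S_f\|\le \begin{cases} \dfrac{2\cos\alpha}{1-\sin|\alpha|} & \text{if } |\alpha|\le \dfrac{\pi}{6},\\[3mm] 8\cos\alpha\,\sin|\alpha| & \text{if } |\alpha|>\dfrac{\pi}{6}. \end{cases} $$ Moreover, the estimates are best possible: for each $\alpha\in(-\pi/2,\pi/2)$, the bound on the right-hand side cannot be replaced by any smaller number valid for all $f\in\mathcal{S}_{\alpha}$.
   Context: $\mathbb{D}=\{z\in\mathbb{C}:|z|<1\}$ is the open unit disk. $\mathcal{A}$ denotes the class of analytic functions $f:\mathbb{D}\to\mathbb{C}$ normalized by $f(0)=0$ and $f'(0)=1$. For $-\pi/2<\alpha<\pi/2$, the Robertson class $\mathcal{S}_{\alpha}$ is the set of $f\in\mathcal{A}$ that are locally univalent (i.e. $f'(z)\neq 0$ for all $z\in\mathbb{D}$) and satisfy $$\operatorname{Re}\left\{e^{i\alpha}\left(1+\frac{zf''(z)}{f'(z)}\right)\right\}>0\quad\text{for all } z\in\mathbb{D}.$$ For a locally univalent analytic function $f$ on $\mathbb{D}$, the Schwarzian derivative and the Schwarzian norm are $$S_f(z)=\left(\frac{f''(z)}{f'(z)}\right)'-\frac12\left(\frac{f''(z)}{f'(z)}\right)^2,\qquad \|S_f\|=\sup_{z\in\mathbb{D}}(1-|z|^2)^2|S_f(z)|.$$ *)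

theory Defs
  imports "HOL-Complex_Analysis.Complex_Analysis"
begin

abbreviation unit_disk :: "complex set" where
  "unit_disk \<equiv> ball 0 1"

definition normalized_analytic :: "(complex \<Rightarrow> complex) set" where
  "normalized_analytic = {f. f holomorphic_on unit_disk \<and> f 0 = 0 \<and> deriv f 0 = 1}"

definition robertson_class :: "real \<Rightarrow> (complex \<Rightarrow> complex) set" where
  "robertson_class \<alpha> = {f \<in> normalized_analytic.
     (\<forall>z\<in>unit_disk. deriv f z \<noteq> 0) \<and>
     (\<forall>z\<in>unit_disk. Re (exp (\<i> * of_real \<alpha>) * (1 + z * deriv (deriv f) z / deriv f z)) > 0)}"

definition schwarzian :: "(complex \<Rightarrow> complex) \<Rightarrow> complex \<Rightarrow> complex" where
  "schwarzian f z =
     deriv (\<lambda>w. deriv (deriv f) w / deriv f w) z - 1/2 * (deriv (deriv f) z / deriv f z)\<^sup>2"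

text \<open>The supremum is taken in the extended reals, since \<^const>\<open>Sup\<close> on the reals is
  unspecified for unbounded sets; an upper bound on the norm thus includes its finiteness.\<close>

definition schwarzian_norm :: "(complex \<Rightarrow> complex) \<Rightarrow> ereal" where
  "schwarzian_norm f =
     (SUP z\<in>unit_disk. ereal ((1 - (cmod z)\<^sup>2)\<^sup>2 * cmod (schwarzian f z)))"

definition robertson_bound :: "real \<Rightarrow> real" where
  "robertson_bound \<alpha> =
     (if \<bar>\<alpha>\<bar> \<le> pi / 6 then 2 * cos \<alpha> / (1 - sin \<bar>\<alpha>\<bar>) else 8 * cos \<alpha> * sin \<bar>\<alpha>\<bar>)"

end

theory Submission
  imports Defs
begin

text \<open>
  Write \<open>c = 2 cos \<alpha> e\<^sup>-\<^sup>i\<^sup>\<alpha>\<close>. The values of \<open>e\<^sup>i\<^sup>\<alpha> (1 + z f'' / f')\<close> lie in the right half plane and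
  the value at the origin is \<open>e\<^sup>i\<^sup>\<alpha>\<close>. Mapping the half plane to the disk and applying the Schwarz
  lemma shows that a normalized locally univalent \<open>f\<close> lies in the Robertson class exactly when
  \<open>f'' / f' = c \<phi> / (1 - z \<phi>)\<close> for a holomorphic \<open>\<phi>\<close> on the disk with \<open>\<bar>\<phi>\<bar> \<le> 1\<close>
  (\<open>robertson_representation\<close>, \<open>robertson_class_of_representation\<close>). In terms of \<open>\<phi>\<close>,
  the Schwarzian derivative is \<open>c (\<phi>' + (1 - c/2) \<phi>\<^sup>2) / (1 - z \<phi>)\<^sup>2\<close>, where
  \<open>\<bar>c\<bar> = 2 cos \<alpha>\<close> and \<open>\<bar>1 - c/2\<bar> = \<bar>sin \<alpha>\<bar>\<close> (\<open>schwarzian_of_representation\<close>).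

  Put \<open>s = \<bar>sin \<alpha>\<bar>\<close>, \<open>r = \<bar>z\<bar>\<close>, \<open>t = \<bar>\<phi> z\<bar>\<close>. The Schwarz-Pick inequality
  \<open>\<bar>\<phi>'\<bar> (1 - r\<^sup>2) \<le> 1 - t\<^sup>2\<close> and \<open>\<bar>1 - z \<phi>\<bar> \<ge> 1 - r t\<close> bound
  \<open>(1 - r\<^sup>2)\<^sup>2 \<bar>S\<bar>\<close> by \<open>2 cos \<alpha>\<close> times
  \<open>F r t = (1 - r\<^sup>2) (1 - k t\<^sup>2) / (1 - r t)\<^sup>2\<close> with \<open>k = 1 - s (1 - r\<^sup>2)\<close>.
  What remains is a problem about two real variables. For fixed \<open>r\<close> the maximum of
  \<open>F r\<close> on the whole interval \<open>t < 1/r\<close> is at \<open>t = r/k\<close>, with value \<open>k / (1 - s)\<close>; when \<open>r/k > 1\<close>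
  the maximum over \<open>t \<le> 1\<close> is at \<open>t = 1\<close>, with value \<open>s (1 + r)\<^sup>2\<close>. As \<open>r\<close> tends to \<open>1\<close> these
  values tend to \<open>1 / (1 - s)\<close> and \<open>4 s\<close>, and in this limit the two regimes are separated by
  \<open>s = 1/2\<close>,
  that is, by \<open>\<bar>\<alpha>\<bar> = \<pi>/6\<close> (\<open>schwarzian_quotient_le\<close>).

  The bound is sharp because all the inequalities can be equalities at once: for given \<open>r\<close> and \<open>t\<close>
  a Blaschke factor \<open>\<phi>\<close> (the constant \<open>1\<close> if \<open>t = 1\<close>) can be chosen with \<open>\<phi> r = t\<close> and with equality in the Schwarz-Pick inequality
  at \<open>r\<close>, and its derivative there can be rotated to have the argument of
  \<open>1 - c/2\<close> (\<open>schwarzian_quotient_attained\<close>).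
\<close>

section \<open>The Schwarz-Pick inequality\<close>

lemma one_minus_mult_nonzero:
  assumes "cmod z < 1" "cmod w \<le> 1"
  shows "1 - z * w \<noteq> 0"
proof
  assume "1 - z * w = 0"
  then have "cmod z * cmod w = 1"
    by (metis norm_mult norm_one right_minus_eq)
  then show False
    using assms by (smt (verit) mult_left_le norm_ge_zero)
qed

lemma Moebius_function_has_field_derivative:
  assumes "1 - cnj w * z \<noteq> 0"
  shows "(Moebius_function 0 w has_field_derivative
            of_real (1 - (cmod w)\<^sup>2) / (1 - cnj w * z)\<^sup>2) (at z)"
proof -
  have "((\<lambda>z. (z - w) / (1 - cnj w * z)) has_field_derivative
           (1 * (1 - cnj w * z) - (z - w) * (0 - cnj w * 1)) / ((1 - cnj w * z) * (1 - cnj w * z))) (at z)"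
    by (rule derivative_eq_intros refl | use assms in simp)+
  moreover have "1 * (1 - cnj w * z) - (z - w) * (0 - cnj w * 1) = of_real (1 - (cmod w)\<^sup>2)"
    by (simp add: algebra_simps flip: complex_norm_square)
  ultimately show ?thesis
    by (simp only: Moebius_function_simple[abs_def] power2_eq_square)
qed

text \<open>Composing with disk automorphisms that take \<open>0\<close> to \<open>a\<close> and \<open>\<phi> a\<close> to \<open>0\<close> gives a self-map of
  the disk that fixes the origin, and the Schwarz lemma bounds its derivative there by \<open>1\<close>.\<close>
lemma Schwarz_Pick_derivative:
  assumes hol: "\<phi> holomorphic_on ball 0 1"
    and maps: "\<And>z. cmod z < 1 \<Longrightarrow> cmod (\<phi> z) < 1"
    and a: "cmod a < 1"
  shows "cmod (deriv \<phi> a) * (1 - (cmod a)\<^sup>2) \<le> 1 - (cmod (\<phi> a))\<^sup>2"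
proof -
  define b where "b = \<phi> a"
  have b: "cmod b < 1" using maps a by (simp add: b_def)
  have a': "cmod (- a) < 1" using a by simp
  define h where "h = Moebius_function 0 b \<circ> (\<phi> \<circ> Moebius_function 0 (- a))"
  have M0: "Moebius_function 0 (- a) 0 = a"
    by (simp add: Moebius_function_of_zero)
  have "h holomorphic_on ball 0 1"
    unfolding h_def
  proof (rule holomorphic_on_compose_gen[where t = "ball 0 1"])
    show "\<phi> \<circ> Moebius_function 0 (- a) holomorphic_on ball 0 1"
      by (rule holomorphic_on_compose_gen[OF Moebius_function_holomorphic[OF a'] hol])
        (use Moebius_function_norm_lt_1[OF a'] in auto)
    show "Moebius_function 0 b holomorphic_on ball 0 1"
      by (rule Moebius_function_holomorphic[OF b])
  qed (use maps Moebius_function_norm_lt_1[OF a'] in auto)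
  moreover have "h 0 = 0"
    using M0 by (simp add: h_def b_def Moebius_function_eq_zero)
  moreover have "cmod (h z) < 1" if "cmod z < 1" for z
    using that by (simp add: h_def Moebius_function_norm_lt_1 maps a b)
  ultimately have le1: "cmod (deriv h 0) \<le> 1"
    using Schwarz_Lemma(2)[of h 0] by simp
  have bb: "1 - cnj b * b = of_real (1 - (cmod b)\<^sup>2)"
    by (simp add: mult.commute flip: complex_norm_square)
  have pos: "1 - (cmod b)\<^sup>2 > 0" "1 - (cmod a)\<^sup>2 > 0"
    using a b by (simp_all add: power_less_one_iff)
  have d1: "(Moebius_function 0 (- a) has_field_derivative of_real (1 - (cmod a)\<^sup>2)) (at 0)"
    using Moebius_function_has_field_derivative[of "- a" 0] by simp
  have d2: "(\<phi> has_field_derivative deriv \<phi> a) (at (Moebius_function 0 (- a) 0))"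
    using holomorphic_derivI[OF hol, of a] a M0 by simp
  have d3: "(Moebius_function 0 b has_field_derivative 1 / of_real (1 - (cmod b)\<^sup>2))
              (at ((\<phi> \<circ> Moebius_function 0 (- a)) 0))"
    using Moebius_function_has_field_derivative[of b b]
      one_minus_mult_nonzero[of "cnj b" b] b pos M0
    unfolding bb by (simp add: b_def power2_eq_square)
  have "(h has_field_derivative
          1 / of_real (1 - (cmod b)\<^sup>2) * (deriv \<phi> a * of_real (1 - (cmod a)\<^sup>2))) (at 0)"
    unfolding h_def by (rule DERIV_chain[OF d3 DERIV_chain[OF d2 d1]])
  then have "deriv h 0 = deriv \<phi> a * of_real (1 - (cmod a)\<^sup>2) / of_real (1 - (cmod b)\<^sup>2)"
    by (simp add: DERIV_imp_deriv)
  then have "cmod (deriv h 0) = cmod (deriv \<phi> a) * (1 - (cmod a)\<^sup>2) / (1 - (cmod b)\<^sup>2)"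
    using pos by (simp only: norm_mult norm_divide norm_of_real) simp
  then show ?thesis
    using le1 pos by (simp add: b_def field_simps)
qed

text \<open>The functions \<open>\<phi>\<close> that represent the Robertson class may be unimodular constants, so the
  inequality is required for maps into the closed disk. It follows from the case of the open disk for
  \<open>\<rho> \<phi>\<close> as \<open>\<rho>\<close> increases to \<open>1\<close>.\<close>
lemma Schwarz_Pick_derivative_closed:
  assumes hol: "\<phi> holomorphic_on ball 0 1"
    and maps: "\<And>z. cmod z < 1 \<Longrightarrow> cmod (\<phi> z) \<le> 1"
    and a: "cmod a < 1"
  shows "cmod (deriv \<phi> a) * (1 - (cmod a)\<^sup>2) \<le> 1 - (cmod (\<phi> a))\<^sup>2"
proof -
  let ?F = "\<lambda>\<rho>. \<rho> * cmod (deriv \<phi> a) * (1 - (cmod a)\<^sup>2) - (1 - (\<rho> * cmod (\<phi> a))\<^sup>2)"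
  have "?F \<rho> \<le> 0" if "0 < \<rho>" "\<rho> < 1" for \<rho> :: real
  proof -
    have "cmod (of_real \<rho> * \<phi> z) < 1" if "cmod z < 1" for z
    proof -
      have "\<rho> * cmod (\<phi> z) \<le> \<rho> * 1"
        using maps[OF that] \<open>0 < \<rho>\<close> by (intro mult_left_mono) auto
      then have "\<rho> * cmod (\<phi> z) < 1" using \<open>\<rho> < 1\<close> by linarith
      then show ?thesis using \<open>0 < \<rho>\<close> by (simp add: norm_mult)
    qed
    then have "cmod (deriv (\<lambda>z. of_real \<rho> * \<phi> z) a) * (1 - (cmod a)\<^sup>2)
        \<le> 1 - (cmod (of_real \<rho> * \<phi> a))\<^sup>2"
      using hol a by (intro Schwarz_Pick_derivative) (auto intro!: holomorphic_intros)
    moreover have "deriv (\<lambda>z. of_real \<rho> * \<phi> z) a = of_real \<rho> * deriv \<phi> a"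
      using hol a by (intro deriv_cmult holomorphic_on_imp_differentiable_at) auto
    ultimately show ?thesis using \<open>0 < \<rho>\<close> by (simp add: norm_mult)
  qed
  then have "eventually (\<lambda>\<rho>. ?F \<rho> \<le> 0) (at_left 1)"
    unfolding eventually_at_left_field by (intro exI[of _ 0]) auto
  moreover have "(?F \<longlongrightarrow> ?F 1) (at_left 1)"
    by (intro tendsto_intros)
  ultimately have "?F 1 \<le> 0"
    by (intro tendsto_upperbound[of ?F "?F 1" "at_left 1" 0]) auto
  then show ?thesis by simp
qed

section \<open>Representation of the Robertson class by bounded functions\<close>

definition robertson_coeff :: "real \<Rightarrow> complex" where
  "robertson_coeff \<alpha> = of_real (2 * cos \<alpha>) * cis (- \<alpha>)"

lemma cis_mult_robertson_coeff: "cis \<alpha> * robertson_coeff \<alpha> = of_real (2 * cos \<alpha>)"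
  by (simp add: robertson_coeff_def mult.left_commute[of "cis \<alpha>"] cis_mult)

lemma norm_robertson_coeff:
  "cos \<alpha> \<ge> 0 \<Longrightarrow> cmod (robertson_coeff \<alpha>) = 2 * cos \<alpha>"
  by (simp add: robertson_coeff_def norm_mult)

lemma one_minus_half_robertson_coeff:
  "1 - robertson_coeff \<alpha> / 2 = of_real (sin \<alpha>) * (\<i> * cis (- \<alpha>))"
  using sin_cos_squared_add2[of \<alpha>] unfolding robertson_coeff_def
  by (auto simp: complex_eq_iff power2_eq_square algebra_simps)

text \<open>In the derivative of \<open>c \<phi> / (1 - z \<phi>)\<close> the terms with \<open>z \<phi> \<phi>'\<close> cancel, which leaves the numerator
  \<open>c (\<phi>' + \<phi>\<^sup>2)\<close>.\<close>
lemma schwarzian_of_representation: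
  assumes hol: "\<phi> holomorphic_on unit_disk"
    and bd: "\<And>z. cmod z < 1 \<Longrightarrow> cmod (\<phi> z) \<le> 1"
    and rep: "\<And>z. cmod z < 1 \<Longrightarrow> deriv (deriv f) z / deriv f z = c * \<phi> z / (1 - z * \<phi> z)"
    and z: "cmod z < 1"
  shows "schwarzian f z = c * (deriv \<phi> z + (1 - c / 2) * (\<phi> z)\<^sup>2) / (1 - z * \<phi> z)\<^sup>2"
proof -
  have nz: "1 - z * \<phi> z \<noteq> 0" using one_minus_mult_nonzero bd z by blast
  have d\<phi>: "(\<phi> has_field_derivative deriv \<phi> z) (at z)"
    using holomorphic_derivI[OF hol] z by simp
  have "((\<lambda>w. c * \<phi> w / (1 - w * \<phi> w)) has_field_derivative
          (c * deriv \<phi> z * (1 - z * \<phi> z) - c * \<phi> z * (0 - (1 * \<phi> z + deriv \<phi> z * z)))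
            / ((1 - z * \<phi> z) * (1 - z * \<phi> z))) (at z)"
    by (rule derivative_eq_intros refl d\<phi> | use nz in simp)+
  then have "((\<lambda>w. deriv (deriv f) w / deriv f w) has_field_derivative
          (c * deriv \<phi> z * (1 - z * \<phi> z) - c * \<phi> z * (0 - (1 * \<phi> z + deriv \<phi> z * z)))
            / ((1 - z * \<phi> z) * (1 - z * \<phi> z))) (at z)"
    by (rule has_field_derivative_transform_within_open[where S = unit_disk])
      (use z rep in auto)
  then have "deriv (\<lambda>w. deriv (deriv f) w / deriv f w) z =
      (c * deriv \<phi> z * (1 - z * \<phi> z) - c * \<phi> z * (0 - (1 * \<phi> z + deriv \<phi> z * z)))
            / ((1 - z * \<phi> z) * (1 - z * \<phi> z))"
    by (rule DERIV_imp_deriv)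
  also have "\<dots> = c * (deriv \<phi> z + (\<phi> z)\<^sup>2) / (1 - z * \<phi> z)\<^sup>2"
    by (simp add: power2_eq_square algebra_simps)
  finally have "schwarzian f z = c * (deriv \<phi> z + (\<phi> z)\<^sup>2) / (1 - z * \<phi> z)\<^sup>2
      - 1/2 * (c\<^sup>2 * (\<phi> z)\<^sup>2 / (1 - z * \<phi> z)\<^sup>2)"
    unfolding schwarzian_def rep[OF z] by (simp only: power_divide power_mult_distrib)
  also have "\<dots> = (c * (deriv \<phi> z + (\<phi> z)\<^sup>2) - 1/2 * (c\<^sup>2 * (\<phi> z)\<^sup>2)) / (1 - z * \<phi> z)\<^sup>2"
    by (simp only: diff_divide_distrib times_divide_eq_right)
  also have "c * (deriv \<phi> z + (\<phi> z)\<^sup>2) - 1/2 * (c\<^sup>2 * (\<phi> z)\<^sup>2) = c * (deriv \<phi> z + (1 - c / 2) * (\<phi> z)\<^sup>2)"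
    by (simp add: power2_eq_square algebra_simps)
  finally show ?thesis .
qed

text \<open>Solving \<open>P = c \<phi> / (1 - z \<phi>)\<close> for \<open>\<phi>\<close>, where \<open>P = f'' / f'\<close>, gives \<open>\<phi> = P / (c + z P)\<close>. The
  Robertson condition says that \<open>z \<phi>\<close> maps into the disk, and then \<open>\<bar>\<phi>\<bar> \<le> 1\<close> is the Schwarz lemma
  for \<open>z \<phi>\<close>.\<close>
lemma robertson_representation:
  assumes cos: "cos \<alpha> > 0" and f: "f \<in> robertson_class \<alpha>"
  obtains \<phi> where "\<phi> holomorphic_on unit_disk"
    and "\<And>z. cmod z < 1 \<Longrightarrow> cmod (\<phi> z) \<le> 1"
    and "\<And>z. cmod z < 1 \<Longrightarrow> deriv (deriv f) z / deriv f z = robertson_coeff \<alpha> * \<phi> z / (1 - z * \<phi> z)"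
proof -
  define c where "c = robertson_coeff \<alpha>"
  define P where "P z = deriv (deriv f) z / deriv f z" for z
  have holf: "f holomorphic_on unit_disk" and nzf: "\<And>z. cmod z < 1 \<Longrightarrow> deriv f z \<noteq> 0"
    and re: "\<And>z. cmod z < 1 \<Longrightarrow> Re (cis \<alpha> * (1 + z * P z)) > 0"
    using f by (auto simp: robertson_class_def normalized_analytic_def P_def cis_conv_exp)
  have holP: "P holomorphic_on unit_disk"
    unfolding P_def using holf nzf by (intro holomorphic_intros) auto
  have c0: "c \<noteq> 0" using cos by (simp add: c_def robertson_coeff_def)
  have cc: "cis \<alpha> * c = of_real (2 * cos \<alpha>)"
    unfolding c_def by (rule cis_mult_robertson_coeff)
  \<comment> \<open>For \<open>q = e\<^sup>i\<^sup>\<alpha> z P\<close> the Robertson condition reads \<open>Re q > - cos \<alpha>\<close>: the point \<open>q\<close> is closer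
    to \<open>0\<close> than to \<open>- 2 cos \<alpha>\<close>.\<close>
  have lt: "cmod (z * P z) < cmod (c + z * P z)" if "cmod z < 1" for z
  proof -
    define q where "q = cis \<alpha> * (z * P z)"
    have "Re q > - cos \<alpha>" using re[OF that] by (simp add: q_def algebra_simps)
    then have "cos \<alpha> * (cos \<alpha> + Re q) > 0" using cos by simp
    then have "(cmod q)\<^sup>2 < (cmod (of_real (2 * cos \<alpha>) + q))\<^sup>2"
      unfolding cmod_power2 by (simp add: power2_eq_square algebra_simps)
    then have "cmod q < cmod (of_real (2 * cos \<alpha>) + q)"
      using power_less_imp_less_base norm_ge_zero by blast
    also have "of_real (2 * cos \<alpha>) + q = cis \<alpha> * (c + z * P z)"
      using cc by (simp add: q_def algebra_simps)
    finally show ?thesis by (simp add: q_def norm_mult)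
  qed
  have nz: "c + z * P z \<noteq> 0" if "cmod z < 1" for z
    using lt[OF that] by auto
  define \<phi> where "\<phi> z = P z / (c + z * P z)" for z
  have hol: "\<phi> holomorphic_on unit_disk"
    unfolding \<phi>_def using holP nz by (intro holomorphic_intros) auto
  have w1: "cmod (z * \<phi> z) < 1" if "cmod z < 1" for z
    using lt[OF that] nz[OF that] by (simp add: \<phi>_def norm_divide norm_mult)
  have holw: "(\<lambda>z. z * \<phi> z) holomorphic_on ball 0 1"
    using hol by (intro holomorphic_intros)
  have bd: "cmod (\<phi> z) \<le> 1" if z: "cmod z < 1" for z
  proof (cases "z = 0")
    \<comment> \<open>At the origin \<open>\<phi>\<close> is the derivative of \<open>z \<phi>\<close>.\<close>
    case True
    have "((\<lambda>z. z * \<phi> z) has_field_derivative 1 * \<phi> 0 + deriv \<phi> 0 * 0) (at 0)"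
      by (intro DERIV_mult DERIV_ident holomorphic_derivI[OF hol]) auto
    then have "deriv (\<lambda>z. z * \<phi> z) 0 = \<phi> 0"
      using DERIV_imp_deriv by force
    then show ?thesis
      using Schwarz_Lemma(2)[OF holw _ w1, of 0] True by simp
  next
    case False
    then show ?thesis
      using Schwarz_Lemma(1)[OF holw _ w1 z] by (simp add: norm_mult)
  qed
  show ?thesis
  proof (rule that[OF hol bd])
    fix z :: complex assume z: "cmod z < 1"
    have "1 - z * \<phi> z = c / (c + z * P z)"
      using nz[OF z] by (simp add: \<phi>_def field_simps)
    then show "deriv (deriv f) z / deriv f z = robertson_coeff \<alpha> * \<phi> z / (1 - z * \<phi> z)"
      using nz[OF z] c0 unfolding P_def[symmetric] c_def[symmetric] by (simp add: \<phi>_def)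
  qed
qed

section \<open>The extremal problem in two real variables\<close>

text \<open>This square shows that \<open>t = r / k\<close> is the unconstrained maximum of the quotient; note that
  \<open>k - r\<^sup>2 = (1 - s) (1 - r\<^sup>2)\<close>.\<close>
lemma schwarzian_quotient_identity:
  fixes r s t :: real
  defines "k \<equiv> 1 - s * (1 - r\<^sup>2)"
  shows "k * (1 - r * t)\<^sup>2 - (1 - s) * ((1 - r\<^sup>2) * (1 - k * t\<^sup>2)) = (k * t - r)\<^sup>2"
  unfolding k_def by (simp add: power2_eq_square algebra_simps)

text \<open>The unconstrained maximum \<open>k / (1 - s)\<close> is a bound for every \<open>t\<close>, whether or not it is attained
  for some \<open>t \<le> 1\<close>; the hypothesis says that \<open>B\<close> is at least this maximum.\<close>
lemma schwarzian_quotient_le_unconstrained: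
  fixes r s t :: real
  assumes r: "0 \<le> r" "r < 1" and s: "0 \<le> s" "s < 1"
    and B: "1 - s * (1 - r\<^sup>2) \<le> B * (1 - s)"
  shows "(1 - r\<^sup>2) * (1 - (1 - s * (1 - r\<^sup>2)) * t\<^sup>2) \<le> B * (1 - r * t)\<^sup>2"
proof -
  define k where "k = 1 - s * (1 - r\<^sup>2)"
  have "(1 - s) * ((1 - r\<^sup>2) * (1 - k * t\<^sup>2)) \<le> k * (1 - r * t)\<^sup>2"
    using schwarzian_quotient_identity[of s r t] zero_le_power2[of "k * t - r"]
    unfolding k_def[symmetric] by linarith
  also have "\<dots> \<le> (B * (1 - s)) * (1 - r * t)\<^sup>2"
    using B by (intro mult_right_mono) (simp_all add: k_def)
  finally have "(1 - s) * ((1 - r\<^sup>2) * (1 - k * t\<^sup>2)) \<le> (1 - s) * (B * (1 - r * t)\<^sup>2)"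
    by (simp add: mult_ac)
  then show ?thesis
    using s unfolding k_def[symmetric] by simp
qed

text \<open>The hypothesis \<open>s (1 + r) \<ge> 1\<close> means \<open>k \<le> r\<close>. The derivative of the quotient in \<open>t\<close> has
  the sign of \<open>r - k t\<close>, so the quotient is nondecreasing on the unit interval, and its value
  \<open>s (1 + r)\<^sup>2\<close> at \<open>t = 1\<close> is at most \<open>4 s\<close>.\<close>
lemma schwarzian_quotient_le_endpoint:
  fixes r s t :: real
  assumes r: "0 \<le> r" "r < 1" and t: "0 \<le> t" "t \<le> 1" and s: "0 \<le> s" "1 \<le> s * (1 + r)"
  shows "(1 - r\<^sup>2) * (1 - (1 - s * (1 - r\<^sup>2)) * t\<^sup>2) \<le> 4 * s * (1 - r * t)\<^sup>2"
proof -
  define k where "k = 1 - s * (1 - r\<^sup>2)"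
  have "r - k = (1 - r) * (s * (1 + r) - 1)"
    by (simp add: k_def power2_eq_square algebra_simps)
  then have kr: "k \<le> r"
    using r s by (smt (verit) mult_nonneg_nonneg)
  \<comment> \<open>The comparison with \<open>t = 1\<close> has the root \<open>t = 1\<close>; the other factor is linear in \<open>t\<close> and is written
    as the interpolation between its values at \<open>0\<close> and \<open>1\<close>.\<close>
  have "(1 - k) * (1 - r * t)\<^sup>2 - (1 - k * t\<^sup>2) * (1 - r)\<^sup>2
      = (1 - t) * ((1 - t) * ((r - k) + r * (1 - r)) + t * (2 * (r - k) * (1 - r)))"
    by (simp add: power2_eq_square algebra_simps)
  also have "\<dots> \<ge> 0"
    using r t kr by (intro mult_nonneg_nonneg add_nonneg_nonneg) auto
  finally have *: "(1 - k * t\<^sup>2) * (1 - r)\<^sup>2 \<le> (1 - k) * (1 - r * t)\<^sup>2"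
    by simp
  have r2: "0 \<le> 1 - r\<^sup>2"
    using r by (simp add: power_le_one)
  have "((1 - r\<^sup>2) * (1 - k * t\<^sup>2)) * (1 - r)\<^sup>2 \<le> (1 - r\<^sup>2) * ((1 - k) * (1 - r * t)\<^sup>2)"
    using mult_left_mono[OF * r2] by (simp add: mult_ac)
  also have "\<dots> = (1 + r)\<^sup>2 * (s * (1 - r * t)\<^sup>2 * (1 - r)\<^sup>2)"
  proof -
    have "1 - r\<^sup>2 = (1 + r) * (1 - r)" "1 - k = s * ((1 + r) * (1 - r))"
      by (simp_all add: k_def power2_eq_square algebra_simps)
    then show ?thesis by (simp only: power2_eq_square mult_ac)
  qed
  also have "\<dots> \<le> 2\<^sup>2 * (s * (1 - r * t)\<^sup>2 * (1 - r)\<^sup>2)"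
    using r s by (intro mult_right_mono power_mono) auto
  finally have "((1 - r\<^sup>2) * (1 - k * t\<^sup>2)) * (1 - r)\<^sup>2 \<le> (4 * s * (1 - r * t)\<^sup>2) * (1 - r)\<^sup>2"
    by (simp add: mult_ac)
  moreover have "(1 - r)\<^sup>2 > 0" using r by simp
  ultimately show ?thesis
    unfolding k_def[symmetric] by (rule mult_right_le_imp_le)
qed

text \<open>For \<open>0 \<le> s < 1\<close> this is the supremum of \<open>F r t\<close> over \<open>0 \<le> r < 1\<close> and \<open>0 \<le> t \<le> 1\<close>.\<close>
definition schwarzian_quotient_bound :: "real \<Rightarrow> real" where
  "schwarzian_quotient_bound s = (if s \<le> 1/2 then 1 / (1 - s) else 4 * s)"

lemma schwarzian_quotient_le:
  fixes r s t :: real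
  assumes r: "0 \<le> r" "r < 1" and t: "0 \<le> t" "t \<le> 1" and s: "0 \<le> s" "s < 1"
  shows "(1 - r\<^sup>2) * (1 - (1 - s * (1 - r\<^sup>2)) * t\<^sup>2) \<le> schwarzian_quotient_bound s * (1 - r * t)\<^sup>2"
proof -
  consider "s \<le> 1/2" | "s > 1/2" "s * (1 + r) \<le> 1" | "s > 1/2" "s * (1 + r) \<ge> 1"
    by linarith
  then show ?thesis
  proof cases
    case 1
    have "0 \<le> s * (1 - r\<^sup>2)" using r s by (simp add: power_le_one)
    then show ?thesis
      using 1 s by (intro schwarzian_quotient_le_unconstrained[OF r s]) (simp add: schwarzian_quotient_bound_def)
  next
    case 2
    \<comment> \<open>Here \<open>s r \<le> 1 - s\<close>, so the unconstrained maximum \<open>k / (1 - s)\<close> is at most \<open>1 / s\<close>, which is below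
      \<open>4 s\<close> as \<open>s > 1/2\<close>.\<close>
    have "(s * r)\<^sup>2 \<le> (1 - s)\<^sup>2"
      using 2 r s by (intro power_mono) (simp_all add: algebra_simps)
    then have "s * (1 - s * (1 - r\<^sup>2)) \<le> 1 - s"
      by (simp add: power2_eq_square algebra_simps)
    also have "1 - s \<le> s * (4 * s * (1 - s))"
    proof -
      have "0 \<le> (1 - s) * ((2 * s - 1) * (2 * s + 1))"
        using 2 s by (intro mult_nonneg_nonneg) auto
      then show ?thesis by (simp add: algebra_simps)
    qed
    finally have "1 - s * (1 - r\<^sup>2) \<le> 4 * s * (1 - s)"
      by (rule mult_left_le_imp_le) (use 2 in simp)
    then show ?thesis
      using 2 schwarzian_quotient_le_unconstrained[OF r s, of "4 * s" t] by (simp add: schwarzian_quotient_bound_def)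
  next
    case 3
    then show ?thesis
      using schwarzian_quotient_le_endpoint[OF r t s(1)] by (simp add: schwarzian_quotient_bound_def)
  qed
qed

section \<open>The upper bound\<close>

lemma robertson_bound_eq:
  assumes "- pi / 2 < \<alpha>" "\<alpha> < pi / 2"
  shows "robertson_bound \<alpha> = 2 * cos \<alpha> * schwarzian_quotient_bound \<bar>sin \<alpha>\<bar>"
proof -
  have s: "sin \<bar>\<alpha>\<bar> = \<bar>sin \<alpha>\<bar>"
    using assms sin_ge_zero[of "\<bar>\<alpha>\<bar>"] by (auto simp: abs_if)
  have "\<bar>\<alpha>\<bar> \<le> pi / 6 \<longleftrightarrow> sin \<bar>\<alpha>\<bar> \<le> sin (pi / 6)"
    using assms by (intro sin_mono_le_eq[symmetric]) auto
  then show ?thesis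
    unfolding robertson_bound_def schwarzian_quotient_bound_def s sin_30 by (auto simp: divide_simps)
qed

lemma cmod_schwarzian_le:
  assumes \<alpha>: "- pi / 2 < \<alpha>" "\<alpha> < pi / 2" and f: "f \<in> robertson_class \<alpha>" and z: "cmod z < 1"
  shows "(1 - (cmod z)\<^sup>2)\<^sup>2 * cmod (schwarzian f z) \<le> robertson_bound \<alpha>"
proof -
  have cos: "cos \<alpha> > 0" using \<alpha> by (intro cos_gt_zero_pi) auto
  obtain \<phi> where hol: "\<phi> holomorphic_on unit_disk"
    and bd: "\<And>z. cmod z < 1 \<Longrightarrow> cmod (\<phi> z) \<le> 1"
    and rep: "\<And>z. cmod z < 1 \<Longrightarrow>
      deriv (deriv f) z / deriv f z = robertson_coeff \<alpha> * \<phi> z / (1 - z * \<phi> z)"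
    using robertson_representation[OF cos f] by blast
  define r where "r = cmod z"
  define t where "t = cmod (\<phi> z)"
  define s where "s = \<bar>sin \<alpha>\<bar>"
  define N where "N = deriv \<phi> z + (1 - robertson_coeff \<alpha> / 2) * (\<phi> z)\<^sup>2"
  have r: "0 \<le> r" "r < 1" and t: "0 \<le> t" "t \<le> 1"
    using z bd by (auto simp: r_def t_def)
  have "(sin \<alpha>)\<^sup>2 < 1" using cos sin_cos_squared_add[of \<alpha>] by (smt (verit) zero_less_power2)
  then have s: "0 \<le> s" "s < 1" by (simp_all add: s_def abs_square_less_1)
  have r2: "0 \<le> 1 - r\<^sup>2" using r by (simp add: power_le_one)
  have "r * t \<le> r * 1" using r t by (intro mult_left_mono) auto
  then have rt: "0 < 1 - r * t" using r by simp
  have den: "1 - r * t \<le> cmod (1 - z * \<phi> z)"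
    using norm_triangle_ineq2[of 1 "z * \<phi> z"] by (simp add: r_def t_def norm_mult)
  have "cmod N \<le> cmod (deriv \<phi> z) + s * t\<^sup>2"
    unfolding N_def one_minus_half_robertson_coeff s_def t_def
    by (rule order_trans[OF norm_triangle_ineq]) (simp add: norm_mult norm_power)
  then have "cmod N * (1 - r\<^sup>2) \<le> cmod (deriv \<phi> z) * (1 - r\<^sup>2) + s * t\<^sup>2 * (1 - r\<^sup>2)"
    using mult_right_mono[OF _ r2, of "cmod N"] by (simp flip: distrib_right)
  also have "\<dots> \<le> (1 - t\<^sup>2) + s * t\<^sup>2 * (1 - r\<^sup>2)"
    using Schwarz_Pick_derivative_closed[OF hol bd z] by (simp add: r_def t_def)
  finally have "(1 - r\<^sup>2) * (cmod N * (1 - r\<^sup>2)) \<le> (1 - r\<^sup>2) * (1 - (1 - s * (1 - r\<^sup>2)) * t\<^sup>2)"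
    by (intro mult_left_mono r2) (simp add: algebra_simps)
  also have "\<dots> \<le> schwarzian_quotient_bound s * (1 - r * t)\<^sup>2"
    by (rule schwarzian_quotient_le[OF r t s])
  also have "\<dots> \<le> schwarzian_quotient_bound s * (cmod (1 - z * \<phi> z))\<^sup>2"
    using den rt s by (intro mult_left_mono power_mono) (auto simp: schwarzian_quotient_bound_def)
  finally have "(1 - r\<^sup>2)\<^sup>2 * cmod N \<le> schwarzian_quotient_bound s * (cmod (1 - z * \<phi> z))\<^sup>2"
    by (simp add: power2_eq_square mult_ac)
  then have "(1 - r\<^sup>2)\<^sup>2 * cmod N / (cmod (1 - z * \<phi> z))\<^sup>2 \<le> schwarzian_quotient_bound s"
    using den rt by (subst pos_divide_le_eq) auto
  then have "2 * cos \<alpha> * ((1 - r\<^sup>2)\<^sup>2 * cmod N / (cmod (1 - z * \<phi> z))\<^sup>2) \<le> 2 * cos \<alpha> * schwarzian_quotient_bound s"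
    using cos by (intro mult_left_mono) auto
  moreover have "cmod (schwarzian f z) = 2 * cos \<alpha> * (cmod N / (cmod (1 - z * \<phi> z))\<^sup>2)"
    using cos schwarzian_of_representation[OF hol bd rep z]
    by (simp add: N_def norm_mult norm_divide norm_power norm_robertson_coeff)
  ultimately show ?thesis
    using robertson_bound_eq[OF \<alpha>] by (simp add: r_def s_def mult_ac)
qed

section \<open>Sharpness\<close>

text \<open>Integrating twice: \<open>f'\<close> is the exponential of a primitive of \<open>P\<close>, so it has no zeros.\<close>
lemma exists_with_prescribed_pre_schwarzian:
  assumes "P holomorphic_on unit_disk"
  obtains f where "f holomorphic_on unit_disk" "f 0 = 0" "deriv f 0 = 1"
    "\<And>z. cmod z < 1 \<Longrightarrow> deriv f z \<noteq> 0"
    "\<And>z. cmod z < 1 \<Longrightarrow> deriv (deriv f) z / deriv f z = P z"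
proof -
  obtain G where G: "\<And>z. z \<in> unit_disk \<Longrightarrow> (G has_field_derivative P z) (at z within unit_disk)"
    using holomorphic_convex_primitive'[OF convex_ball open_ball assms] by blast
  then have G': "(G has_field_derivative P z) (at z)" if "cmod z < 1" for z
    using G[of z] that by (simp add: at_within_open[of z unit_disk])
  define g where "g z = exp (G z - G 0)" for z
  have dg: "(g has_field_derivative P z * g z) (at z)" if "cmod z < 1" for z
    unfolding g_def by (rule derivative_eq_intros G'[OF that] refl | simp)+
  have "g holomorphic_on unit_disk"
    unfolding holomorphic_on_open[OF open_ball] by (intro ballI exI, rule dg) simp
  then obtain F where F: "\<And>z. z \<in> unit_disk \<Longrightarrow> (F has_field_derivative g z) (at z within unit_disk)"
    by (rule holomorphic_convex_primitive'[OF convex_ball open_ball]) blast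
  define f where "f z = F z - F 0" for z
  have df: "(f has_field_derivative g z) (at z)" if "cmod z < 1" for z
  proof -
    have "(F has_field_derivative g z) (at z)"
      using F[of z] that by (simp add: at_within_open[of z unit_disk])
    from DERIV_diff[OF this DERIV_const] show ?thesis
      unfolding f_def by simp
  qed
  then have df': "deriv f z = g z" if "cmod z < 1" for z
    using that DERIV_imp_deriv by blast
  have "(deriv f has_field_derivative P z * g z) (at z)" if "cmod z < 1" for z
    by (rule has_field_derivative_transform_within_open[OF dg[OF that], where S = unit_disk])
      (use that df' in auto)
  then have ddf: "deriv (deriv f) z = P z * g z" if "cmod z < 1" for z
    using that DERIV_imp_deriv by blast
  show ?thesis
  proof (rule that)
    show "f holomorphic_on unit_disk"
      unfolding holomorphic_on_open[OF open_ball] by (intro ballI exI, rule df) simp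
  qed (auto simp: df' ddf g_def f_def)
qed

text \<open>Converse of the representation above: with \<open>w = z \<phi>\<close>, the real part in the Robertson condition is
  \<open>cos \<alpha>\<close> times the real part of the Cayley transform \<open>(1 + w) / (1 - w)\<close>, which is positive on the
  disk.\<close>
lemma robertson_class_of_representation:
  assumes cos: "cos \<alpha> > 0"
    and hol: "\<phi> holomorphic_on unit_disk"
    and bd: "\<And>z. cmod z < 1 \<Longrightarrow> cmod (\<phi> z) \<le> 1"
  obtains f where "f \<in> robertson_class \<alpha>"
    and "\<And>z. cmod z < 1 \<Longrightarrow> deriv (deriv f) z / deriv f z = robertson_coeff \<alpha> * \<phi> z / (1 - z * \<phi> z)"
proof -
  define c where "c = robertson_coeff \<alpha>"
  have nz: "1 - z * \<phi> z \<noteq> 0" if "cmod z < 1" for z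
    using one_minus_mult_nonzero bd that by blast
  have "(\<lambda>z. c * \<phi> z / (1 - z * \<phi> z)) holomorphic_on unit_disk"
    using nz by (intro holomorphic_intros hol) auto
  then obtain f where f: "f holomorphic_on unit_disk" "f 0 = 0" "deriv f 0 = 1"
    "\<And>z. cmod z < 1 \<Longrightarrow> deriv f z \<noteq> 0"
    and rep: "\<And>z. cmod z < 1 \<Longrightarrow> deriv (deriv f) z / deriv f z = c * \<phi> z / (1 - z * \<phi> z)"
    using exists_with_prescribed_pre_schwarzian by blast
  have "Re (cis \<alpha> * (1 + z * deriv (deriv f) z / deriv f z)) > 0" if z: "cmod z < 1" for z
  proof -
    define w where "w = z * \<phi> z"
    have "cmod w \<le> cmod z * 1"
      unfolding w_def norm_mult by (intro mult_left_mono bd z) auto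
    then have w: "cmod w < 1" using z by simp
    have w1: "w \<noteq> 1" using nz[OF z] by (simp add: w_def)
    have cc: "cis \<alpha> * c = of_real (2 * cos \<alpha>)"
      unfolding c_def by (rule cis_mult_robertson_coeff)
    have "cis \<alpha> * (1 + z * deriv (deriv f) z / deriv f z) = cis \<alpha> + (cis \<alpha> * c) * (w / (1 - w))"
      unfolding times_divide_eq_right[symmetric] rep[OF z] w_def by (simp add: algebra_simps)
    also have "\<dots> = of_real (cos \<alpha>) * ((1 + w) / (1 - w)) + \<i> * of_real (sin \<alpha>)"
      unfolding cc using w1 by (simp add: field_simps cis_conv_exp exp_Euler cos_of_real sin_of_real)
    finally have p: "cis \<alpha> * (1 + z * deriv (deriv f) z / deriv f z)
        = of_real (cos \<alpha>) * ((1 + w) / (1 - w)) + \<i> * of_real (sin \<alpha>)" .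
    have Re_times_of_real: "Re (of_real x * y) = x * Re y" for x y by simp
    have "Re (cis \<alpha> * (1 + z * deriv (deriv f) z / deriv f z))
        = cos \<alpha> * Re ((1 + w) / (1 - w))"
      unfolding p by (simp only: plus_complex.sel Re_times_of_real) simp
    also have "Re ((1 + w) / (1 - w)) = (1 - (cmod w)\<^sup>2) / (cmod (1 - w))\<^sup>2"
      unfolding Re_divide cmod_power2 by (simp add: power2_eq_square algebra_simps)
    also have "cos \<alpha> * \<dots> > 0"
      using cos w w1 by (intro mult_pos_pos divide_pos_pos) (auto simp: power_less_one_iff)
    finally show ?thesis .
  qed
  then have "f \<in> robertson_class \<alpha>"
    using f by (auto simp: robertson_class_def normalized_analytic_def cis_conv_exp)
  then show ?thesis using that rep unfolding c_def by blast
qed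

text \<open>The map is a disk automorphism sending \<open>r\<close> to \<open>0\<close>, followed by the rotation by \<open>u\<close> and the
  automorphism sending \<open>0\<close> to \<open>t\<close>. Automorphisms give equality in the Schwarz-Pick inequality. For
  \<open>t = 1\<close> the same formula degenerates to the constant \<open>1\<close>, which covers both regimes of the
  extremal problem at once.\<close>
lemma exists_extremal_self_map:
  fixes r t :: real and u :: complex
  assumes r: "0 \<le> r" "r < 1" and t: "0 \<le> t" "t \<le> 1" and u: "cmod u = 1"
  obtains \<phi> where "\<phi> holomorphic_on unit_disk"
    and "\<And>z. cmod z < 1 \<Longrightarrow> cmod (\<phi> z) \<le> 1"
    and "\<phi> (of_real r) = of_real t"
    and "deriv \<phi> (of_real r) = u * of_real ((1 - t\<^sup>2) / (1 - r\<^sup>2))"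
proof -
  define \<psi> where "\<psi> z = u * Moebius_function 0 (of_real r) z" for z
  define \<phi> where "\<phi> z = (\<psi> z + of_real t) / (1 + of_real t * \<psi> z)" for z
  have \<psi>1: "cmod (\<psi> z) < 1" if "cmod z < 1" for z
    using Moebius_function_norm_lt_1[of "of_real r" z 0] r that u by (simp add: \<psi>_def norm_mult)
  have nz: "1 + of_real t * \<psi> z \<noteq> 0" if "cmod z < 1" for z
    using one_minus_mult_nonzero[of "- \<psi> z" "of_real t"] \<psi>1[OF that] t by (simp add: mult.commute)
  have hol\<psi>: "\<psi> holomorphic_on unit_disk"
    unfolding \<psi>_def using r by (intro holomorphic_intros Moebius_function_holomorphic) auto
  have hol: "\<phi> holomorphic_on unit_disk"
    unfolding \<phi>_def using nz by (intro holomorphic_intros hol\<psi>) auto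
  have bd: "cmod (\<phi> z) \<le> 1" if z: "cmod z < 1" for z
  proof -
    have "(cmod (1 + of_real t * \<psi> z))\<^sup>2 - (cmod (\<psi> z + of_real t))\<^sup>2 = (1 - t\<^sup>2) * (1 - (cmod (\<psi> z))\<^sup>2)"
      unfolding cmod_power2 by (simp add: power2_eq_square algebra_simps)
    also have "\<dots> \<ge> 0"
      using t \<psi>1[OF z] by (intro mult_nonneg_nonneg) (auto simp: power_le_one)
    finally have "cmod (\<psi> z + of_real t) \<le> cmod (1 + of_real t * \<psi> z)"
      using power2_le_imp_le norm_ge_zero by (smt (verit))
    then show ?thesis using nz[OF z] by (simp add: \<phi>_def norm_divide)
  qed
  have r2: "1 - r\<^sup>2 > 0" using r by (simp add: power_less_one_iff)
  then have r2': "(1 - of_real r * of_real r :: complex) \<noteq> 0"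
    by (metis less_irrefl of_real_1 of_real_diff of_real_eq_0_iff of_real_mult power2_eq_square)
  have \<psi>r: "\<psi> (of_real r) = 0" by (simp add: \<psi>_def Moebius_function_eq_zero)
  have "(\<psi> has_field_derivative u * (of_real (1 - r\<^sup>2) / (1 - of_real r * of_real r)\<^sup>2)) (at (of_real r))"
    unfolding \<psi>_def
    using Moebius_function_has_field_derivative[of "of_real r" "of_real r"] r2' r
    by (intro DERIV_cmult) simp
  moreover have "of_real (1 - r\<^sup>2) / (1 - of_real r * of_real r :: complex)\<^sup>2 = 1 / of_real (1 - r\<^sup>2)"
    using r2' by (simp add: power2_eq_square)
  ultimately have d\<psi>: "(\<psi> has_field_derivative u * (1 / of_real (1 - r\<^sup>2))) (at (of_real r))"
    by (simp only:)
  have "(\<phi> has_field_derivative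
      ((u * (1 / of_real (1 - r\<^sup>2)) + 0) * (1 + of_real t * \<psi> (of_real r))
         - (\<psi> (of_real r) + of_real t) * (0 + of_real t * (u * (1 / of_real (1 - r\<^sup>2)))))
       / ((1 + of_real t * \<psi> (of_real r)) * (1 + of_real t * \<psi> (of_real r)))) (at (of_real r))"
    unfolding \<phi>_def
    by (intro DERIV_divide DERIV_add DERIV_cmult DERIV_const d\<psi>) (simp add: \<psi>r)
  then have "deriv \<phi> (of_real r) = u * (1 / of_real (1 - r\<^sup>2)) - of_real t * (of_real t * (u * (1 / of_real (1 - r\<^sup>2))))"
    by (simp add: DERIV_imp_deriv \<psi>r)
  also have "\<dots> = u * of_real ((1 - t\<^sup>2) / (1 - r\<^sup>2))"
    by (simp add: power2_eq_square diff_divide_distrib algebra_simps)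
  finally show ?thesis
    using that hol bd \<psi>r by (simp add: \<phi>_def)
qed

text \<open>The extremal self-map is used with a unit number \<open>u\<close> such that \<open>1 - c/2 = s u\<close>, so that \<open>\<phi>'\<close> and
  \<open>(1 - c/2) \<phi>\<^sup>2\<close> point in the same direction at \<open>r\<close> and no triangle inequality is lost. There
  \<open>z \<phi> = r t\<close> is a nonnegative real number, so \<open>\<bar>1 - z \<phi>\<bar> = 1 - r t\<close>.\<close>
lemma schwarzian_quotient_attained:
  fixes r t :: real
  assumes \<alpha>: "- pi / 2 < \<alpha>" "\<alpha> < pi / 2" and r: "0 \<le> r" "r < 1" and t: "0 \<le> t" "t \<le> 1"
  obtains f where "f \<in> robertson_class \<alpha>"
    and "ereal (2 * cos \<alpha> * ((1 - r\<^sup>2) * (1 - (1 - \<bar>sin \<alpha>\<bar> * (1 - r\<^sup>2)) * t\<^sup>2) / (1 - r * t)\<^sup>2))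
           \<le> schwarzian_norm f"
proof -
  have cos: "cos \<alpha> > 0" using \<alpha> by (intro cos_gt_zero_pi) auto
  define s where "s = \<bar>sin \<alpha>\<bar>"
  define u where "u = (if sin \<alpha> \<ge> 0 then \<i> * cis (- \<alpha>) else - (\<i> * cis (- \<alpha>)))"
  have u: "cmod u = 1" by (simp add: u_def norm_mult)
  have su: "1 - robertson_coeff \<alpha> / 2 = of_real s * u"
    unfolding one_minus_half_robertson_coeff by (simp add: u_def s_def)
  obtain \<phi> where hol: "\<phi> holomorphic_on unit_disk"
    and bd: "\<And>z. cmod z < 1 \<Longrightarrow> cmod (\<phi> z) \<le> 1"
    and \<phi>r: "\<phi> (of_real r) = of_real t"
    and d\<phi>r: "deriv \<phi> (of_real r) = u * of_real ((1 - t\<^sup>2) / (1 - r\<^sup>2))"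
    using exists_extremal_self_map[OF r t u] by blast
  obtain f where f: "f \<in> robertson_class \<alpha>"
    and rep: "\<And>z. cmod z < 1 \<Longrightarrow>
      deriv (deriv f) z / deriv f z = robertson_coeff \<alpha> * \<phi> z / (1 - z * \<phi> z)"
    using robertson_class_of_representation[OF cos hol bd] by blast
  have zr: "cmod (of_real r) < 1" using r by simp
  have r2: "1 - r\<^sup>2 > 0" using r by (simp add: power_less_one_iff)
  have "schwarzian f (of_real r) = robertson_coeff \<alpha> * (u * of_real ((1 - t\<^sup>2) / (1 - r\<^sup>2) + s * t\<^sup>2))
      / of_real ((1 - r * t)\<^sup>2)"
    using schwarzian_of_representation[OF hol bd rep zr] unfolding \<phi>r d\<phi>r su
    by (simp add: algebra_simps)
  then have "cmod (schwarzian f (of_real r))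
      = 2 * cos \<alpha> * \<bar>(1 - t\<^sup>2) / (1 - r\<^sup>2) + s * t\<^sup>2\<bar> / (1 - r * t)\<^sup>2"
    using cos u by (simp only: norm_mult norm_divide norm_of_real norm_robertson_coeff) simp
  also have "\<bar>(1 - t\<^sup>2) / (1 - r\<^sup>2) + s * t\<^sup>2\<bar> = (1 - t\<^sup>2) / (1 - r\<^sup>2) + s * t\<^sup>2"
    using r2 t by (intro abs_of_nonneg add_nonneg_nonneg divide_nonneg_pos mult_nonneg_nonneg)
      (auto simp: power_le_one s_def)
  also have "\<dots> = (1 - (1 - s * (1 - r\<^sup>2)) * t\<^sup>2) / (1 - r\<^sup>2)"
    using r2 by (simp add: field_simps)
  finally have "(1 - (cmod (of_real r))\<^sup>2)\<^sup>2 * cmod (schwarzian f (of_real r))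
      = 2 * cos \<alpha> * ((1 - r\<^sup>2) * (1 - (1 - s * (1 - r\<^sup>2)) * t\<^sup>2) / (1 - r * t)\<^sup>2)"
    using r2 by (simp add: power2_eq_square)
  moreover have "ereal ((1 - (cmod (of_real r))\<^sup>2)\<^sup>2 * cmod (schwarzian f (of_real r))) \<le> schwarzian_norm f"
    unfolding schwarzian_norm_def by (rule SUP_upper) (use r in auto)
  ultimately show ?thesis
    using that[OF f] unfolding s_def by (simp only:)
qed

text \<open>Evaluate the quotient at its maximizing \<open>t\<close>, which for \<open>r\<close> near \<open>1\<close> is \<open>r / k\<close> if \<open>s \<le> 1/2\<close> and \<open>1\<close>
  otherwise, and let \<open>r\<close> tend to \<open>1\<close>.\<close>
lemma robertson_bound_le_uniform_bound:
  assumes \<alpha>: "- pi / 2 < \<alpha>" "\<alpha> < pi / 2"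
    and M: "\<And>f. f \<in> robertson_class \<alpha> \<Longrightarrow> schwarzian_norm f \<le> ereal M"
  shows "robertson_bound \<alpha> \<le> M"
proof -
  define s where "s = \<bar>sin \<alpha>\<bar>"
  have cos: "cos \<alpha> > 0" using \<alpha> by (intro cos_gt_zero_pi) auto
  have le: "2 * cos \<alpha> * ((1 - r\<^sup>2) * (1 - (1 - s * (1 - r\<^sup>2)) * t\<^sup>2) / (1 - r * t)\<^sup>2) \<le> M"
    if "0 \<le> r" "r < 1" "0 \<le> t" "t \<le> 1" for r t
  proof (rule schwarzian_quotient_attained[OF \<alpha> that])
    fix f assume f: "f \<in> robertson_class \<alpha>"
      and *: "ereal (2 * cos \<alpha> * ((1 - r\<^sup>2) * (1 - (1 - \<bar>sin \<alpha>\<bar> * (1 - r\<^sup>2)) * t\<^sup>2) / (1 - r * t)\<^sup>2))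
        \<le> schwarzian_norm f"
    show ?thesis
      using order_trans[OF * M[OF f]] unfolding s_def by (simp only: ereal_less_eq)
  qed
  have limit: "L 1 \<le> M" if "continuous_on UNIV L" "\<And>r. 0 < r \<Longrightarrow> r < 1 \<Longrightarrow> L r \<le> M"
    for L :: "real \<Rightarrow> real"
  proof (rule tendsto_upperbound)
    have "isCont L 1" using that(1) by (simp add: continuous_on_eq_continuous_at)
    then show "(L \<longlongrightarrow> L 1) (at_left 1)"
      unfolding isCont_def by (rule tendsto_mono[OF at_le, rotated]) simp
    show "eventually (\<lambda>r. L r \<le> M) (at_left 1)"
      unfolding eventually_at_left_field using that(2) by (intro exI[of _ 0]) auto
  qed simp
  have "2 * cos \<alpha> * schwarzian_quotient_bound s \<le> M"
  proof (cases "s \<le> 1/2")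
    case True
    have "2 * cos \<alpha> * (1 + s * r\<^sup>2 / (1 - s)) \<le> M" if r: "0 < r" "r < 1" for r
    proof -
      define k where "k = 1 - s * (1 - r\<^sup>2)"
      have s1: "0 < 1 - s" using True by simp
      have "k - r = (1 - r) * (1 - s * (1 + r))"
        by (simp add: k_def power2_eq_square algebra_simps)
      also have "\<dots> > 0"
      proof -
        have "s * (1 + r) \<le> 1/2 * (1 + r)" using True r by (intro mult_right_mono) auto
        also have "1/2 * (1 + r) < 1" using r by simp
        finally show ?thesis using r by (intro mult_pos_pos) auto
      qed
      finally have k: "r < k" by simp
      then have k0: "k > 0" using r by simp
      have kr2: "k - r\<^sup>2 = (1 - s) * (1 - r\<^sup>2)" by (simp add: k_def algebra_simps)
      have r2: "1 - r\<^sup>2 > 0" using r by (simp add: power_less_one_iff)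
      have q: "1 - r * (r / k) = (1 - s) * (1 - r\<^sup>2) / k" "1 - k * (r / k)\<^sup>2 = (1 - s) * (1 - r\<^sup>2) / k"
        using k0 kr2 by (simp_all add: field_simps power2_eq_square)
      have "(1 - r\<^sup>2) * (1 - k * (r / k)\<^sup>2) / (1 - r * (r / k))\<^sup>2 = k / (1 - s)"
        unfolding q using k0 s1 r2 by (simp add: power2_eq_square)
      also have "\<dots> = 1 + s * r\<^sup>2 / (1 - s)"
        using s1 by (simp add: k_def field_simps)
      finally show ?thesis
        using le[of r "r / k"] r k k0 unfolding k_def[symmetric] by simp
    qed
    then have "2 * cos \<alpha> * (1 + s * 1\<^sup>2 / (1 - s)) \<le> M"
      using True by (intro limit[of "\<lambda>r. 2 * cos \<alpha> * (1 + s * r\<^sup>2 / (1 - s))"] continuous_intros) auto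
    moreover have "1 + s * 1\<^sup>2 / (1 - s) = 1 / (1 - s)" using True by (simp add: field_simps)
    ultimately show ?thesis using True by (simp add: schwarzian_quotient_bound_def)
  next
    case False
    have "2 * cos \<alpha> * (s * (1 + r)\<^sup>2) \<le> M" if r: "0 < r" "r < 1" for r
    proof -
      have e: "1 - r\<^sup>2 = (1 + r) * (1 - r)" by (simp add: power2_eq_square algebra_simps)
      have "(1 - r\<^sup>2) * (1 - (1 - s * (1 - r\<^sup>2)) * 1\<^sup>2) / (1 - r * 1)\<^sup>2 = s * (1 + r)\<^sup>2"
        unfolding e using r by (simp add: power2_eq_square)
      then show ?thesis using le[of r 1] r by simp
    qed
    then have "2 * cos \<alpha> * (s * (1 + 1)\<^sup>2) \<le> M"
      by (intro limit[of "\<lambda>r. 2 * cos \<alpha> * (s * (1 + r)\<^sup>2)"] continuous_intros) auto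
    then show ?thesis using False by (simp add: schwarzian_quotient_bound_def mult_ac)
  qed
  then show ?thesis using robertson_bound_eq[OF \<alpha>] by (simp add: s_def)
qed

theorem theorem2p2:
  fixes \<alpha> :: real
  assumes "- pi / 2 < \<alpha>" and "\<alpha> < pi / 2"
  shows "(\<forall>f\<in>robertson_class \<alpha>. schwarzian_norm f \<le> ereal (robertson_bound \<alpha>)) \<and>
         (\<forall>M::real. M < robertson_bound \<alpha> \<longrightarrow>
            \<not> (\<forall>f\<in>robertson_class \<alpha>. schwarzian_norm f \<le> ereal M))"
proof (intro conjI ballI allI impI notI)
  fix f assume "f \<in> robertson_class \<alpha>"
  then show "schwarzian_norm f \<le> ereal (robertson_bound \<alpha>)"
    unfolding schwarzian_norm_def using cmod_schwarzian_le[OF assms] by (intro SUP_least) auto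
next
  fix M assume "M < robertson_bound \<alpha>"
    and "\<forall>f\<in>robertson_class \<alpha>. schwarzian_norm f \<le> ereal M"
  then show False
    using robertson_bound_le_uniform_bound[OF assms, of M] by auto
qed

end
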